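(* Let $E^{\mathrm{ce}}$ be an equivalence relation on $\omega$ extending $=^{\mathrm{ce}}$. If $E^{\mathrm{ce}}<_{\mathrm{Learn}}\mathrm{Id}_1$ (equivalently, if $E^{\mathrm{ce}}$ is not universal), then there is an order embedding $$\iota\colon(\mathcal{P}_{\mathrm{fin}}(2^{\omega}),\subseteq)\to(\mathcal{E}^{\mathrm{ce}},\leq)$$ such that: (i) $\iota(\emptyset)=[E^{\mathrm{ce}}]_{\equiv_{\mathrm{Learn}}}$; (ii) for every $P\in\mathcal{P}_{\mathrm{fin}}(2^{\omega})$, we have $\iota(P)<[\mathrm{Id}_1]_{\equiv_{\mathrm{Learn}}}$. In particular, $\mathsf{TLH}=(\mathcal{E}^{\mathrm{ce}},\leq)$ is coatomless.
   Context: Fix a standard (acceptable) enumeration $(\varphi_e)_{e\in\omega}$ of the partial computable functions and let $W_e=\operatorname{dom}(\varphi_e)$. Write $e=^{\mathrm{ce}}e'$ iff $W_e=W_{e'}$. Let $\mathcal{R}^{\mathrm{ce}}$ be the set of all equivalence relations on $\omega$ extending $=^{\mathrm{ce}}$ (no definability or effectivity is assumed). $\mathrm{Id}_1$ is the one-class equivalence relation on $\omega$. An enumeration of a set $A$ is a surjection $\mu:\omega\to A$; $\mu[s]$ denotes the finite string $\mu(0),\dots,\mu(s-1)$. A learner is an arbitrary function $\mathbf{M}:\omega^{<\omega}\to\omega$ (no effectivity is assumed). For $E^{\mathrm{ce}}\in\mathcal{R}^{\mathrm{ce}}$, a family $\mathfrak{K}$ of nonempty c.e. sets is $E^{\mathrm{ce}}$-learnable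 if there is a learner $\mathbf{M}$ such that for every $e$ with $W_e\in\mathfrak{K}$ and every enumeration $\mu$ of $W_e$ there is $i\in\omega$ with $i\mathrel{E^{\mathrm{ce}}}e$ and $\mathbf{M}(\mu[s])=i$ for all sufficiently large $s$. $E^{\mathrm{ce}}$ is universal if every family of nonempty c.e. sets is $E^{\mathrm{ce}}$-learnable. $E^{\mathrm{ce}}\leq_{\mathrm{Learn}}F^{\mathrm{ce}}$ means that every $E^{\mathrm{ce}}$-learnable family of nonempty c.e. sets is also $F^{\mathrm{ce}}$-learnable; $<_{\mathrm{Learn}}$ is the strict part of this preorder and $\equiv_{\mathrm{Learn}}$ is mutual reducibility. The tolerant learning hierarchy $\mathsf{TLH}$ is the poset $(\mathcal{E}^{\mathrm{ce}},\leq)$ where $\mathcal{E}^{\mathrm{ce}}=\mathcal{R}^{\mathrm{ce}}/{\equiv_{\mathrm{Learn}}}$ and $\leq$ is induced by $\leq_{\mathrm{Learn}}$; its top element is $[\mathrm{Id}_1]_{\equiv_{\mathrm{Learn}}}$. $\mathcal{P}_{\mathrm{fin}}(X)$ is the set of all finite subsets of $X$. In a poset with top $\top$, a coatom is an element $a<\top$ such that there is no $b$ with $a<b<\top$; the poset is coatomless if it has no coatoms. *)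

theory Defs
  imports Main
begin

section \<open>Partial computable functions and acceptable numberings\<close>

text \<open>
  Programs carry no arity annotation. On inputs of any fixed length a program computes a partial
  recursive function of that arity in the usual sense; an ill-formed program is undefined.
\<close>

datatype recf =
    Zero
  | Succ
  | Proj nat
  | Comp recf "recf list"
  | PrimRec recf recf
  | Mu recf

fun rec_eval :: "recf \<Rightarrow> nat list \<Rightarrow> nat option" where
  "rec_eval Zero xs = Some 0"
| "rec_eval Succ xs = (case xs of [x] \<Rightarrow> Some (Suc x) | _ \<Rightarrow> None)"
| "rec_eval (Proj i) xs = (if i < length xs then Some (xs ! i) else None)"
| "rec_eval (Comp f gs) xs =
    (if \<forall>g\<in>set gs. rec_eval g xs \<noteq> None
     then rec_eval f (map (\<lambda>g. the (rec_eval g xs)) gs) else None)"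
| "rec_eval (PrimRec f g) xs =
    (case xs of [] \<Rightarrow> None
     | n # ys \<Rightarrow> rec_nat (rec_eval f ys)
         (\<lambda>m r. case r of None \<Rightarrow> None | Some v \<Rightarrow> rec_eval g (m # v # ys)) n)"
| "rec_eval (Mu f) xs =
    (if \<exists>n. rec_eval f (n # xs) = Some 0 \<and> (\<forall>m<n. rec_eval f (m # xs) \<noteq> None)
     then Some (LEAST n. rec_eval f (n # xs) = Some 0) else None)"

definition partial_computable :: "(nat \<Rightarrow> nat option) \<Rightarrow> bool" where
  "partial_computable f \<longleftrightarrow> (\<exists>p. \<forall>x. f x = rec_eval p [x])"

definition partial_computable2 :: "(nat \<Rightarrow> nat \<Rightarrow> nat option) \<Rightarrow> bool" where
  "partial_computable2 f \<longleftrightarrow> (\<exists>p. \<forall>x y. f x y = rec_eval p [x, y])"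

definition total_computable :: "(nat \<Rightarrow> nat) \<Rightarrow> bool" where
  "total_computable f \<longleftrightarrow> partial_computable (\<lambda>x. Some (f x))"

text \<open>
  Acceptable in the sense of Rogers: an enumeration of exactly the unary partial computable
  functions that satisfies the enumeration theorem and the s-m-n theorem.
\<close>

definition acceptable_numbering :: "(nat \<Rightarrow> nat \<Rightarrow> nat option) \<Rightarrow> bool" where
  "acceptable_numbering \<phi> \<longleftrightarrow>
     range \<phi> = {f. partial_computable f} \<and>
     partial_computable2 \<phi> \<and>
     (\<forall>\<psi>. partial_computable2 \<psi> \<longrightarrow>
        (\<exists>s. total_computable s \<and> (\<forall>e. \<phi> (s e) = \<psi> e)))"

definition W :: "(nat \<Rightarrow> nat \<Rightarrow> nat option) \<Rightarrow> nat \<Rightarrow> nat set" where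
  "W \<phi> e = dom (\<phi> e)"

definition eq_ce :: "(nat \<Rightarrow> nat \<Rightarrow> nat option) \<Rightarrow> nat rel" where
  "eq_ce \<phi> = {(e, e'). W \<phi> e = W \<phi> e'}"

definition R_ce :: "(nat \<Rightarrow> nat \<Rightarrow> nat option) \<Rightarrow> nat rel set" where
  "R_ce \<phi> = {E. equiv UNIV E \<and> eq_ce \<phi> \<subseteq> E}"

definition Id_1 :: "nat rel" where
  "Id_1 = UNIV"

section \<open>Learnability\<close>

definition ce_family :: "(nat \<Rightarrow> nat \<Rightarrow> nat option) \<Rightarrow> nat set set \<Rightarrow> bool" where
  "ce_family \<phi> K \<longleftrightarrow> K \<subseteq> range (W \<phi>) \<and> {} \<notin> K"

definition enumeration :: "(nat \<Rightarrow> nat) \<Rightarrow> nat set \<Rightarrow> bool" where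
  "enumeration \<mu> A \<longleftrightarrow> range \<mu> = A"

definition initial_segment :: "(nat \<Rightarrow> nat) \<Rightarrow> nat \<Rightarrow> nat list" where
  "initial_segment \<mu> s = map \<mu> [0..<s]"

definition learnable ::
    "(nat \<Rightarrow> nat \<Rightarrow> nat option) \<Rightarrow> nat rel \<Rightarrow> nat set set \<Rightarrow> bool" where
  "learnable \<phi> E K \<longleftrightarrow>
     (\<exists>M :: nat list \<Rightarrow> nat. \<forall>e \<mu>. W \<phi> e \<in> K \<longrightarrow> enumeration \<mu> (W \<phi> e) \<longrightarrow>
        (\<exists>i. (i, e) \<in> E \<and> (\<exists>s0. \<forall>s\<ge>s0. M (initial_segment \<mu> s) = i)))"

definition universal :: "(nat \<Rightarrow> nat \<Rightarrow> nat option) \<Rightarrow> nat rel \<Rightarrow> bool" where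
  "universal \<phi> E \<longleftrightarrow> (\<forall>K. ce_family \<phi> K \<longrightarrow> learnable \<phi> E K)"

definition learn_le :: "(nat \<Rightarrow> nat \<Rightarrow> nat option) \<Rightarrow> nat rel \<Rightarrow> nat rel \<Rightarrow> bool" where
  "learn_le \<phi> E F \<longleftrightarrow> (\<forall>K. ce_family \<phi> K \<longrightarrow> learnable \<phi> E K \<longrightarrow> learnable \<phi> F K)"

definition learn_less :: "(nat \<Rightarrow> nat \<Rightarrow> nat option) \<Rightarrow> nat rel \<Rightarrow> nat rel \<Rightarrow> bool" where
  "learn_less \<phi> E F \<longleftrightarrow> learn_le \<phi> E F \<and> \<not> learn_le \<phi> F E"

definition learn_equiv :: "(nat \<Rightarrow> nat \<Rightarrow> nat option) \<Rightarrow> nat rel rel" where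
  "learn_equiv \<phi> = {(E, F). E \<in> R_ce \<phi> \<and> F \<in> R_ce \<phi> \<and> learn_le \<phi> E F \<and> learn_le \<phi> F E}"

section \<open>Posets given by a carrier and an order predicate\<close>

definition strictly_below :: "('a \<Rightarrow> 'a \<Rightarrow> bool) \<Rightarrow> 'a \<Rightarrow> 'a \<Rightarrow> bool" where
  "strictly_below le x y \<longleftrightarrow> le x y \<and> x \<noteq> y"

definition order_embedding ::
    "'a set \<Rightarrow> ('a \<Rightarrow> 'a \<Rightarrow> bool) \<Rightarrow> 'b set \<Rightarrow> ('b \<Rightarrow> 'b \<Rightarrow> bool) \<Rightarrow> ('a \<Rightarrow> 'b) \<Rightarrow> bool" where
  "order_embedding A le B le' f \<longleftrightarrow>
     f ` A \<subseteq> B \<and> (\<forall>x\<in>A. \<forall>y\<in>A. le x y \<longleftrightarrow> le' (f x) (f y))"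

definition is_top :: "'a set \<Rightarrow> ('a \<Rightarrow> 'a \<Rightarrow> bool) \<Rightarrow> 'a \<Rightarrow> bool" where
  "is_top A le t \<longleftrightarrow> t \<in> A \<and> (\<forall>x\<in>A. le x t)"

definition coatom :: "'a set \<Rightarrow> ('a \<Rightarrow> 'a \<Rightarrow> bool) \<Rightarrow> 'a \<Rightarrow> bool" where
  "coatom A le a \<longleftrightarrow> a \<in> A \<and>
     (\<exists>t. is_top A le t \<and> strictly_below le a t \<and>
        \<not> (\<exists>b\<in>A. strictly_below le a b \<and> strictly_below le b t))"

definition coatomless :: "'a set \<Rightarrow> ('a \<Rightarrow> 'a \<Rightarrow> bool) \<Rightarrow> bool" where
  "coatomless A le \<longleftrightarrow> \<not> (\<exists>a. coatom A le a)"

section \<open>The tolerant learning hierarchy\<close>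

definition TLH :: "(nat \<Rightarrow> nat \<Rightarrow> nat option) \<Rightarrow> nat rel set set" where
  "TLH \<phi> = R_ce \<phi> // learn_equiv \<phi>"

definition TLH_le ::
    "(nat \<Rightarrow> nat \<Rightarrow> nat option) \<Rightarrow> nat rel set \<Rightarrow> nat rel set \<Rightarrow> bool" where
  "TLH_le \<phi> X Y \<longleftrightarrow> (\<exists>E\<in>X. \<exists>F\<in>Y. learn_le \<phi> E F)"

definition learn_class :: "(nat \<Rightarrow> nat \<Rightarrow> nat option) \<Rightarrow> nat rel \<Rightarrow> nat rel set" where
  "learn_class \<phi> E = learn_equiv \<phi> `` {E}"

lemma learn_le_refl: "learn_le \<phi> E E"
  by (simp add: learn_le_def)

lemma learn_le_trans: "learn_le \<phi> E F \<Longrightarrow> learn_le \<phi> F G \<Longrightarrow> learn_le \<phi> E G"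
  by (simp add: learn_le_def)

lemma equiv_learn_equiv: "equiv (R_ce \<phi>) (learn_equiv \<phi>)"
  by (rule equivI)
    (auto simp: learn_equiv_def refl_on_def sym_def trans_def
      intro: learn_le_refl learn_le_trans)

lemma Id_1_in_R_ce: "Id_1 \<in> R_ce \<phi>"
  by (auto simp: R_ce_def Id_1_def equiv_def refl_on_def sym_def trans_def)

lemma universal_Id_1: "universal \<phi> Id_1"
  unfolding universal_def learnable_def Id_1_def by (auto intro!: exI[of _ "\<lambda>_. 0"])

lemma learn_le_Id_1: "learn_le \<phi> E Id_1"
  using universal_Id_1 by (simp add: universal_def learn_le_def)

lemma learn_class_in_TLH: "E \<in> R_ce \<phi> \<Longrightarrow> learn_class \<phi> E \<in> TLH \<phi>"
  by (simp add: TLH_def learn_class_def quotientI)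

lemma TLH_le_learn_class:
  assumes "E \<in> R_ce \<phi>" "F \<in> R_ce \<phi>"
  shows "TLH_le \<phi> (learn_class \<phi> E) (learn_class \<phi> F) \<longleftrightarrow> learn_le \<phi> E F"
  using assms unfolding TLH_le_def learn_class_def learn_equiv_def
  by (auto intro: learn_le_refl learn_le_trans)

lemma TLH_cases:
  assumes "X \<in> TLH \<phi>"
  obtains E where "E \<in> R_ce \<phi>" "X = learn_class \<phi> E"
  using assms by (auto simp: TLH_def learn_class_def elim: quotientE)

lemma learn_class_eq_iff:
  assumes "E \<in> R_ce \<phi>" "F \<in> R_ce \<phi>"
  shows "learn_class \<phi> E = learn_class \<phi> F \<longleftrightarrow> learn_le \<phi> E F \<and> learn_le \<phi> F E"
  using assms eq_equiv_class_iff[OF equiv_learn_equiv assms]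
  by (simp add: learn_class_def learn_equiv_def)

lemma TLH_poset:
  "reflp_on (TLH \<phi>) (TLH_le \<phi>)"
  "antisymp_on (TLH \<phi>) (TLH_le \<phi>)"
  "transp_on (TLH \<phi>) (TLH_le \<phi>)"
proof -
  show "reflp_on (TLH \<phi>) (TLH_le \<phi>)"
    by (auto intro!: reflp_onI elim!: TLH_cases simp: TLH_le_learn_class learn_le_refl)
  show "antisymp_on (TLH \<phi>) (TLH_le \<phi>)"
  proof (rule antisymp_onI)
    fix X Y assume "X \<in> TLH \<phi>" "Y \<in> TLH \<phi>" "TLH_le \<phi> X Y" "TLH_le \<phi> Y X"
    then show "X = Y"
      by (metis TLH_cases TLH_le_learn_class learn_class_eq_iff)
  qed
  show "transp_on (TLH \<phi>) (TLH_le \<phi>)"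
    by (auto intro!: transp_onI elim!: TLH_cases simp: TLH_le_learn_class
        intro: learn_le_trans)
qed

lemma TLH_top: "is_top (TLH \<phi>) (TLH_le \<phi>) (learn_class \<phi> Id_1)"
  by (auto simp: is_top_def Id_1_in_R_ce learn_class_in_TLH TLH_le_learn_class learn_le_Id_1
      elim!: TLH_cases)

end

theory Submission
  imports Defs "HOL-Library.Countable" "HOL-Library.Infinite_Set"
begin

text \<open>
  A family is learnable iff each member \<open>A\<close> has a finite tell-tale \<open>D \<subseteq> A\<close>: every member lying
  between \<open>D\<close> and \<open>A\<close> is equivalent to \<open>A\<close> (Angluin's criterion with all effectivity dropped).
  So, if \<open>E\<close> is not universal, some c.e. set \<open>A\<close> is the limit from below of c.e. sets \<open>B\<^sub>n\<close> that are
  not equivalent to \<open>A\<close>. Thinning out, the \<open>B\<^sub>n\<close> may be placed in intervals \<open>[D\<^sub>n, B\<^sub>n]\<close> with finite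
  \<open>D\<^sub>n\<close> increasing to \<open>A\<close>, no interval containing another \<open>B\<^sub>m\<close>. For \<open>S \<subseteq> \<omega>\<close> move all sets in the
  intervals with \<open>n \<in> S\<close> to the class of \<open>A\<close>. Away from \<open>A\<close> the moved region is locally constant for
  convergence from below, so the result is monotone in \<open>S\<close>, while the result for \<open>S\<close> is not
  below the one for \<open>T\<close> when \<open>S - T\<close> is infinite. An almost disjoint family of subsets of \<open>\<omega>\<close>
  indexed by \<open>2\<^sup>\<omega>\<close> then yields the embedding.
\<close>

section \<open>Tell-tales\<close>

definition telltale ::
    "(nat \<Rightarrow> nat \<Rightarrow> nat option) \<Rightarrow> nat rel \<Rightarrow> nat set set \<Rightarrow> nat \<Rightarrow> nat set \<Rightarrow> bool" where
  "telltale \<phi> E K a D \<longleftrightarrow> finite D \<and> D \<subseteq> W \<phi> a \<and>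
     (\<forall>b. W \<phi> b \<in> K \<longrightarrow> D \<subseteq> W \<phi> b \<longrightarrow> W \<phi> b \<subseteq> W \<phi> a \<longrightarrow> (b, a) \<in> E)"

lemma set_initial_segment: "set (initial_segment \<mu> s) = \<mu> ` {..<s}"
  by (auto simp: initial_segment_def)

lemma finite_subset_initial_segment:
  assumes "finite D" "D \<subseteq> range \<mu>"
  shows "\<exists>s0. \<forall>s\<ge>s0. D \<subseteq> set (initial_segment \<mu> s)"
proof -
  obtain I where I: "finite I" "D = \<mu> ` I"
    using finite_subset_image[OF assms] by blast
  then obtain s0 where "\<forall>i\<in>I. i < s0"
    using finite_nat_set_iff_bounded by blast
  then have "\<forall>s\<ge>s0. D \<subseteq> set (initial_segment \<mu> s)"
    unfolding set_initial_segment I by fastforce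
  then show ?thesis ..
qed

text \<open>The learner guesses the least index \<open>a\<close> whose tell-tale has appeared and
  whose set contains all data so far. On an enumeration of \<open>W \<phi> e\<close> this converges
  to the least \<open>i\<close> that fits \<open>W \<phi> e\<close> itself, and \<open>i\<close> is
  equivalent to \<open>e\<close> because \<open>W \<phi> e\<close> lies between \<open>D i\<close>
  and \<open>W \<phi> i\<close>.\<close>

lemma learnable_if_telltales:
  assumes "sym E" and tt: "\<And>a. W \<phi> a \<in> K \<Longrightarrow> \<exists>D. telltale \<phi> E K a D"
  shows "learnable \<phi> E K"
proof -
  obtain D where D: "\<And>a. W \<phi> a \<in> K \<Longrightarrow> telltale \<phi> E K a (D a)"
    using tt by metis
  define fits where "fits X a \<longleftrightarrow> W \<phi> a \<in> K \<and> D a \<subseteq> X \<and> X \<subseteq> W \<phi> a" for X a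
  have "\<exists>i. (i, e) \<in> E \<and> (\<exists>s0. \<forall>s\<ge>s0. (LEAST a. fits (set (initial_segment \<mu> s)) a) = i)"
    if e: "W \<phi> e \<in> K" and \<mu>: "range \<mu> = W \<phi> e" for e \<mu>
  proof -
    define i where "i = (LEAST a. fits (W \<phi> e) a)"
    have "fits (W \<phi> e) e"
      using D[OF e] e by (auto simp: fits_def telltale_def)
    then have i: "fits (W \<phi> e) i"
      unfolding i_def by (rule LeastI)
    have "(e, i) \<in> E"
      using i D[of i] e by (auto simp: fits_def telltale_def)
    then have "(i, e) \<in> E"
      using \<open>sym E\<close> by (meson symD)
    \<comment> \<open>Every smaller index is refuted for good: its tell-tale never appears in full,
      or a datum outside its set eventually does.\<close>
    have "\<forall>a<i. \<exists>s0. \<forall>s\<ge>s0. \<not> fits (set (initial_segment \<mu> s)) a"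
    proof (intro allI impI)
      fix a assume "a < i"
      then have "\<not> fits (W \<phi> e) a"
        unfolding i_def by (rule not_less_Least)
      then consider "W \<phi> a \<notin> K" | "\<not> D a \<subseteq> W \<phi> e" | x where "x \<in> W \<phi> e" "x \<notin> W \<phi> a"
        by (auto simp: fits_def)
      then show "\<exists>s0. \<forall>s\<ge>s0. \<not> fits (set (initial_segment \<mu> s)) a"
      proof cases
        case 3
        then obtain s0 where "\<forall>s\<ge>s0. {x} \<subseteq> set (initial_segment \<mu> s)"
          using finite_subset_initial_segment[of "{x}" \<mu>] \<mu> by auto
        then show ?thesis
          using 3 by (auto simp: fits_def)
      next
        case 2
        then show ?thesis
          using \<mu> by (fastforce simp: fits_def set_initial_segment)
      qed (auto simp: fits_def)
    qed
    then obtain f where f: "\<forall>a<i. \<forall>s\<ge>f a. \<not> fits (set (initial_segment \<mu> s)) a"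
      by metis
    have "finite (D i)" "D i \<subseteq> range \<mu>"
      using i D[of i] \<mu> by (auto simp: fits_def telltale_def)
    then obtain s1 where s1: "\<forall>s\<ge>s1. D i \<subseteq> set (initial_segment \<mu> s)"
      using finite_subset_initial_segment by metis
    obtain s2 where s2: "\<forall>k\<in>f ` {..<i}. k \<le> s2"
      using finite_nat_set_iff_bounded_le by blast
    have "(LEAST a. fits (set (initial_segment \<mu> s)) a) = i" if "s \<ge> max s1 s2" for s
    proof (rule Least_equality)
      show "fits (set (initial_segment \<mu> s)) i"
        using i s1 that \<mu> by (auto simp: fits_def set_initial_segment)
      show "i \<le> a" if "fits (set (initial_segment \<mu> s)) a" for a
      proof (rule ccontr)
        assume "\<not> i \<le> a"
        then have "f a \<le> s"
          using s2 \<open>s \<ge> max s1 s2\<close>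
          by (meson imageI lessThan_iff max.cobounded2 not_le order_trans)
        then show False using f that \<open>\<not> i \<le> a\<close> by auto
      qed
    qed
    then show ?thesis
      using \<open>(i, e) \<in> E\<close> by blast
  qed
  then show ?thesis
    unfolding learnable_def enumeration_def
    by (intro exI[of _ "\<lambda>\<sigma>. LEAST a. fits (set \<sigma>) a"]) blast
qed

section \<open>Locking sequences: from learners to tell-tales\<close>

lemma prefix_chain_enumeration:
  fixes \<sigma> :: "nat \<Rightarrow> nat list"
  assumes chain: "\<And>n. \<exists>\<tau>. \<sigma> (Suc n) = \<sigma> n @ \<tau>" and len: "\<And>n. n \<le> length (\<sigma> n)"
  obtains \<mu> where "\<And>n. initial_segment \<mu> (length (\<sigma> n)) = \<sigma> n"
    and "range \<mu> = (\<Union>n. set (\<sigma> n))"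
proof
  \<comment> \<open>The length bound guarantees a position \<open>i\<close> from stage
    \<open>Suc i\<close> on.\<close>
  define \<mu> where "\<mu> i = \<sigma> (Suc i) ! i" for i
  have ext: "\<exists>\<tau>. \<sigma> (n + k) = \<sigma> n @ \<tau>" for n k
  proof (induction k)
    case (Suc k)
    then show ?case using chain[of "n + k"] by auto
  qed simp
  have nth: "\<sigma> m ! i = \<sigma> n ! i" if "i < length (\<sigma> m)" "i < length (\<sigma> n)" for i m n
  proof (cases "m \<le> n")
    case True
    then obtain \<tau> where "\<sigma> n = \<sigma> m @ \<tau>" using ext[of m "n - m"] by auto
    then show ?thesis using that by (simp add: nth_append)
  next
    case False
    then obtain \<tau> where "\<sigma> m = \<sigma> n @ \<tau>" using ext[of n "m - n"] by auto
    then show ?thesis using that by (simp add: nth_append)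
  qed
  have \<mu>: "\<mu> i = \<sigma> n ! i" if "i < length (\<sigma> n)" for i n
    unfolding \<mu>_def using that len[of "Suc i"] by (intro nth) auto
  show seg: "initial_segment \<mu> (length (\<sigma> n)) = \<sigma> n" for n
    by (rule nth_equalityI) (auto simp: initial_segment_def \<mu>)
  show "range \<mu> = (\<Union>n. set (\<sigma> n))"
  proof
    show "range \<mu> \<subseteq> (\<Union>n. set (\<sigma> n))"
    proof
      fix x assume "x \<in> range \<mu>"
      then obtain i where "x = \<sigma> (Suc i) ! i" by (auto simp: \<mu>_def)
      then have "x \<in> set (\<sigma> (Suc i))" using len[of "Suc i"] by simp
      then show "x \<in> (\<Union>n. set (\<sigma> n))" by blast
    qed
    show "(\<Union>n. set (\<sigma> n)) \<subseteq> range \<mu>"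
    proof (rule UN_least)
      show "set (\<sigma> n) \<subseteq> range \<mu>" for n
        using set_initial_segment[of \<mu> "length (\<sigma> n)"] unfolding seg by blast
    qed
  qed
qed

text \<open>The Blum-Blum argument, with \<open>I\<close> the set of correct guesses. Without a
  locking string, every string with a guess in \<open>I\<close> extends within \<open>A\<close> to
  one with a different guess. Iterating this while also feeding in all of \<open>A\<close> gives an
  enumeration on which \<open>M\<close> cannot settle on a value in \<open>I\<close>.\<close>

lemma locking_sequence:
  assumes "A \<noteq> {}"
    and lim: "\<And>\<mu>. range \<mu> = A \<Longrightarrow> \<exists>i\<in>I. \<exists>s0. \<forall>s\<ge>s0. M (initial_segment \<mu> s) = i"
  shows "\<exists>\<sigma>\<in>lists A. M \<sigma> \<in> I \<and> (\<forall>\<tau>\<in>lists A. M (\<sigma> @ \<tau>) = M \<sigma>)"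
proof (rule ccontr)
  assume "\<not> ?thesis"
  then have "\<exists>\<tau>. \<tau> \<in> lists A \<and> (M \<sigma> \<in> I \<longrightarrow> M (\<sigma> @ \<tau>) \<noteq> M \<sigma>)" if "\<sigma> \<in> lists A" for \<sigma>
    using that by (cases "M \<sigma> \<in> I") (blast intro: lists.Nil)+
  then obtain t where t: "\<And>\<sigma>. \<sigma> \<in> lists A \<Longrightarrow> t \<sigma> \<in> lists A"
    and bad: "\<And>\<sigma>. \<sigma> \<in> lists A \<Longrightarrow> M \<sigma> \<in> I \<Longrightarrow> M (\<sigma> @ t \<sigma>) \<noteq> M \<sigma>"
    by metis
  obtain x0 where "x0 \<in> A"
    using \<open>A \<noteq> {}\<close> by blast
  \<comment> \<open>Appending \<open>\<nu> n\<close> at stage \<open>n\<close> ensures that all of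
    \<open>A\<close> gets listed; \<open>x0\<close> is a filler for numbers outside
    \<open>A\<close>.\<close>
  define \<nu> where "\<nu> n = (if n \<in> A then n else x0)" for n
  have \<nu>: "\<nu> n \<in> A" for n
    using \<open>x0 \<in> A\<close> by (simp add: \<nu>_def)
  define \<sigma> where "\<sigma> = rec_nat [] (\<lambda>n \<sigma>. \<sigma> @ t \<sigma> @ [\<nu> n])"
  have \<sigma>_Suc: "\<sigma> (Suc n) = \<sigma> n @ t (\<sigma> n) @ [\<nu> n]" for n
    by (simp add: \<sigma>_def)
  have \<sigma>_lists: "\<sigma> n \<in> lists A" for n
  proof (induction n)
    case 0
    then show ?case by (simp add: \<sigma>_def)
  next
    case (Suc n)
    then show ?case using t[OF Suc] \<nu> by (simp add: \<sigma>_Suc)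
  qed
  have len: "n \<le> length (\<sigma> n)" for n
    by (induction n) (auto simp: \<sigma>_Suc)
  obtain \<mu> where \<mu>: "\<And>n. initial_segment \<mu> (length (\<sigma> n)) = \<sigma> n"
    and range_\<mu>: "range \<mu> = (\<Union>n. set (\<sigma> n))"
    using prefix_chain_enumeration[OF _ len] \<sigma>_Suc by blast
  have "range \<mu> = A"
  proof
    show "range \<mu> \<subseteq> A"
      using \<sigma>_lists unfolding range_\<mu> by (auto simp: in_lists_conv_set)
    show "A \<subseteq> range \<mu>"
    proof
      fix x assume "x \<in> A"
      then have "x \<in> set (\<sigma> (Suc x))" by (simp add: \<sigma>_Suc \<nu>_def)
      then show "x \<in> range \<mu>" unfolding range_\<mu> by blast
    qed
  qed
  then obtain i s0 where "i \<in> I" and i: "\<And>s. s \<ge> s0 \<Longrightarrow> M (initial_segment \<mu> s) = i"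
    using lim by metis
  have "M (\<sigma> s0) = i"
    using i[of "length (\<sigma> s0)"] len \<mu> by simp
  \<comment> \<open>The mind change occurs strictly inside the chain, before \<open>\<nu> s0\<close>
    is appended, so this intermediate string must be seen to be a prefix of \<open>\<mu>\<close>
    too.\<close>
  moreover have "initial_segment \<mu> (length (\<sigma> s0 @ t (\<sigma> s0))) = \<sigma> s0 @ t (\<sigma> s0)"
  proof -
    have "initial_segment \<mu> (length (\<sigma> s0 @ t (\<sigma> s0))) =
        take (length (\<sigma> s0 @ t (\<sigma> s0))) (initial_segment \<mu> (length (\<sigma> (Suc s0))))"
      by (simp add: initial_segment_def take_map \<sigma>_Suc)
    also have "\<dots> = \<sigma> s0 @ t (\<sigma> s0)"
      unfolding \<mu> by (simp add: \<sigma>_Suc)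
    finally show ?thesis .
  qed
  then have "M (\<sigma> s0 @ t (\<sigma> s0)) = i"
    using i[of "length (\<sigma> s0 @ t (\<sigma> s0))"] len[of s0] by (metis le_add1 length_append order_trans)
  ultimately show False
    using bad[OF \<sigma>_lists] \<open>i \<in> I\<close> by metis
qed

text \<open>The content of a locking sequence \<open>\<sigma>\<close> for \<open>W \<phi> a\<close>
  is a tell-tale: if \<open>W \<phi> b\<close> lies in between, then \<open>\<sigma>\<close>
  followed by an enumeration of \<open>W \<phi> b\<close> still enumerates
  \<open>W \<phi> b\<close>, and \<open>M\<close> never leaves \<open>M \<sigma>\<close> on it. So
  \<open>M \<sigma>\<close> is equivalent to both \<open>a\<close> and \<open>b\<close>.\<close>

lemma telltales_if_learnable:
  assumes E: "sym E" "trans E" and "{} \<notin> K" and "learnable \<phi> E K" and a: "W \<phi> a \<in> K"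
  shows "\<exists>D. telltale \<phi> E K a D"
proof -
  obtain M where M: "\<And>e \<mu>. W \<phi> e \<in> K \<Longrightarrow> range \<mu> = W \<phi> e \<Longrightarrow>
      \<exists>i. (i, e) \<in> E \<and> (\<exists>s0. \<forall>s\<ge>s0. M (initial_segment \<mu> s) = i)"
    using \<open>learnable \<phi> E K\<close> unfolding learnable_def enumeration_def by blast
  have "\<exists>\<sigma>\<in>lists (W \<phi> a). M \<sigma> \<in> {i. (i, a) \<in> E} \<and> (\<forall>\<tau>\<in>lists (W \<phi> a). M (\<sigma> @ \<tau>) = M \<sigma>)"
  proof (rule locking_sequence)
    show "W \<phi> a \<noteq> {}" using a \<open>{} \<notin> K\<close> by metis
  qed (use M[OF a] in blast)
  then obtain \<sigma> where \<sigma>: "set \<sigma> \<subseteq> W \<phi> a" "(M \<sigma>, a) \<in> E"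
    and lock: "\<And>\<tau>. set \<tau> \<subseteq> W \<phi> a \<Longrightarrow> M (\<sigma> @ \<tau>) = M \<sigma>"
    by (fastforce simp: lists_eq_set)
  have "(b, a) \<in> E" if b: "W \<phi> b \<in> K" "set \<sigma> \<subseteq> W \<phi> b" "W \<phi> b \<subseteq> W \<phi> a" for b
  proof -
    obtain x0 where "x0 \<in> W \<phi> b" using b \<open>{} \<notin> K\<close> by fastforce
    define \<nu> where "\<nu> n = (if n \<in> W \<phi> b then n else x0)" for n
    have \<nu>: "range \<nu> = W \<phi> b"
      using \<open>x0 \<in> W \<phi> b\<close> by (auto simp: \<nu>_def image_iff)
    define \<mu> where "\<mu> n = (if n < length \<sigma> then \<sigma> ! n else \<nu> (n - length \<sigma>))" for n
    have seg: "initial_segment \<mu> (length \<sigma> + k) = \<sigma> @ initial_segment \<nu> k" for k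
      by (rule nth_equalityI) (auto simp: initial_segment_def nth_append \<mu>_def)
    have "range \<mu> = W \<phi> b"
    proof
      show "range \<mu> \<subseteq> W \<phi> b"
        using \<nu> b(2) by (auto simp: \<mu>_def)
      show "W \<phi> b \<subseteq> range \<mu>"
      proof
        fix x assume "x \<in> W \<phi> b"
        then have "\<mu> (length \<sigma> + x) = x" by (simp add: \<mu>_def \<nu>_def)
        then show "x \<in> range \<mu>" by (metis rangeI)
      qed
    qed
    from M[OF b(1) this] obtain i s0 where "(i, b) \<in> E"
      and i: "\<And>s. s \<ge> s0 \<Longrightarrow> M (initial_segment \<mu> s) = i"
      by metis
    have "M (\<sigma> @ initial_segment \<nu> s0) = i"
      using i[of "length \<sigma> + s0"] unfolding seg by simp
    moreover have "M (\<sigma> @ initial_segment \<nu> s0) = M \<sigma>"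
      using \<nu> b(3) by (intro lock) (auto simp: set_initial_segment)
    ultimately show "(b, a) \<in> E"
      using \<open>(i, b) \<in> E\<close> \<sigma>(2) E by (metis symD transD)
  qed
  then have "telltale \<phi> E K a (set \<sigma>)"
    using \<sigma> by (simp add: telltale_def)
  then show ?thesis ..
qed

section \<open>The tell-tale criterion for learnability and for reducibility\<close>

lemma R_ceD:
  assumes "E \<in> R_ce \<phi>"
  shows "refl E" "sym E" "trans E" "W \<phi> e = W \<phi> e' \<Longrightarrow> (e, e') \<in> E"
  using assms by (auto simp: R_ce_def eq_ce_def equiv_def)

lemma learnable_iff_telltales:
  assumes "E \<in> R_ce \<phi>" "ce_family \<phi> K"
  shows "learnable \<phi> E K \<longleftrightarrow> (\<forall>a. W \<phi> a \<in> K \<longrightarrow> (\<exists>D. telltale \<phi> E K a D))"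
proof
  have "{} \<notin> K"
    using assms(2) by (simp add: ce_family_def)
  then show "\<forall>a. W \<phi> a \<in> K \<longrightarrow> (\<exists>D. telltale \<phi> E K a D)" if "learnable \<phi> E K"
    using telltales_if_learnable[OF R_ceD(2,3)[OF assms(1)]] that by simp
qed (simp add: learnable_if_telltales[OF R_ceD(2)[OF assms(1)]])

text \<open>A test that mentions no families: \<open>E\<close> need only be contained in
  \<open>F\<close> near each set from below, since adding the finite set of the third hypothesis to
  a tell-tale for \<open>E\<close> gives one for \<open>F\<close>.\<close>

lemma learn_leI:
  assumes "E \<in> R_ce \<phi>" "F \<in> R_ce \<phi>"
    and "\<And>a. \<exists>D. finite D \<and> D \<subseteq> W \<phi> a \<and>
      (\<forall>b. D \<subseteq> W \<phi> b \<longrightarrow> W \<phi> b \<subseteq> W \<phi> a \<longrightarrow> (b, a) \<in> E \<longrightarrow> (b, a) \<in> F)"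
  shows "learn_le \<phi> E F"
  unfolding learn_le_def
proof (intro allI impI)
  fix K assume K: "ce_family \<phi> K" "learnable \<phi> E K"
  have "\<exists>D. telltale \<phi> F K a D" if a: "W \<phi> a \<in> K" for a
  proof -
    obtain D where D: "telltale \<phi> E K a D"
      using K a assms(1) learnable_iff_telltales by blast
    obtain D' where D': "finite D'" "D' \<subseteq> W \<phi> a"
      "\<And>b. D' \<subseteq> W \<phi> b \<Longrightarrow> W \<phi> b \<subseteq> W \<phi> a \<Longrightarrow> (b, a) \<in> E \<Longrightarrow> (b, a) \<in> F"
      using assms(3) by metis
    have "telltale \<phi> F K a (D \<union> D')"
      using D D' by (auto simp: telltale_def)
    then show ?thesis ..
  qed
  then show "learnable \<phi> F K"
    using K(1) assms(2) learnable_iff_telltales by blast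
qed

lemma learn_less_Id_1_iff: "learn_less \<phi> E Id_1 \<longleftrightarrow> \<not> universal \<phi> E"
  using universal_Id_1[of \<phi>] learn_le_Id_1[of \<phi> E]
  by (auto simp: learn_less_def learn_le_def universal_def)

section \<open>Approximating sequences\<close>

lemma not_universal_approximable:
  assumes E: "E \<in> R_ce \<phi>" and "\<not> universal \<phi> E"
  obtains a where "W \<phi> a \<noteq> {}"
    and "\<And>D. finite D \<Longrightarrow> D \<subseteq> W \<phi> a \<Longrightarrow>
      \<exists>b. D \<subseteq> W \<phi> b \<and> W \<phi> b \<subset> W \<phi> a \<and> W \<phi> b \<noteq> {} \<and> (b, a) \<notin> E"
proof -
  obtain K where K: "ce_family \<phi> K" "\<not> learnable \<phi> E K"
    using \<open>\<not> universal \<phi> E\<close> by (auto simp: universal_def)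
  then obtain a where a: "W \<phi> a \<in> K" "\<And>D. \<not> telltale \<phi> E K a D"
    using E learnable_iff_telltales by blast
  have "{} \<notin> K"
    using K(1) by (simp add: ce_family_def)
  show thesis
  proof
    show "W \<phi> a \<noteq> {}" using a \<open>{} \<notin> K\<close> by metis
  next
    fix D assume "finite D" "D \<subseteq> W \<phi> a"
    then obtain b where b: "W \<phi> b \<in> K" "D \<subseteq> W \<phi> b" "W \<phi> b \<subseteq> W \<phi> a" "(b, a) \<notin> E"
      using a(2)[of D] by (auto simp: telltale_def)
    \<comment> \<open>The inclusion is strict because indices of equal sets are equivalent.\<close>
    then show "\<exists>b. D \<subseteq> W \<phi> b \<and> W \<phi> b \<subset> W \<phi> a \<and> W \<phi> b \<noteq> {} \<and> (b, a) \<notin> E"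
      using R_ceD(4)[OF E] \<open>{} \<notin> K\<close> by (intro exI[of _ b]) (metis psubsetI)
  qed
qed

text \<open>The finite sets \<open>D\<^sub>n\<close> are
  \<open>W \<phi> a \<inter> {..<k n}\<close>, and \<open>k_ge\<close> makes them exhaust
  \<open>W \<phi> a\<close>. The thinning out is \<open>b_next\<close>: the next finite set already
  escapes \<open>W \<phi> (b n)\<close>.\<close>

locale approximation =
  fixes \<phi> :: "nat \<Rightarrow> nat \<Rightarrow> nat option" and E :: "nat rel"
    and a :: nat and b :: "nat \<Rightarrow> nat" and k :: "nat \<Rightarrow> nat"
  assumes E: "E \<in> R_ce \<phi>"
    and a_nonempty: "W \<phi> a \<noteq> {}"
    and b_nonempty: "W \<phi> (b n) \<noteq> {}"
    and b_below: "W \<phi> (b n) \<subset> W \<phi> a"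
    and b_above: "W \<phi> a \<inter> {..<k n} \<subseteq> W \<phi> (b n)"
    and b_next: "\<not> W \<phi> a \<inter> {..<k (Suc n)} \<subseteq> W \<phi> (b n)"
    and b_not_E: "(b n, a) \<notin> E"
    and k_mono: "k n \<le> k (Suc n)"
    and k_ge: "n \<le> k n"

lemma approximation_exists:
  assumes E: "E \<in> R_ce \<phi>" and "\<not> universal \<phi> E"
  obtains a b k where "approximation \<phi> E a b k"
proof -
  obtain a where a: "W \<phi> a \<noteq> {}"
    and ex: "\<And>D. finite D \<Longrightarrow> D \<subseteq> W \<phi> a \<Longrightarrow>
      \<exists>b. D \<subseteq> W \<phi> b \<and> W \<phi> b \<subset> W \<phi> a \<and> W \<phi> b \<noteq> {} \<and> (b, a) \<notin> E"
    using not_universal_approximable[OF assms] by metis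
  define P where "P n = (\<lambda>(b, k). n \<le> k \<and> W \<phi> a \<inter> {..<k} \<subseteq> W \<phi> b \<and> W \<phi> b \<subset> W \<phi> a \<and>
      W \<phi> b \<noteq> {} \<and> (b, a) \<notin> E)" for n :: nat
  define Q where "Q = (\<lambda>(b, k) (b' :: nat, k'). k \<le> k' \<and> \<not> W \<phi> a \<inter> {..<k'} \<subseteq> W \<phi> b)"
  have ex': "\<exists>b. W \<phi> a \<inter> {..<k} \<subseteq> W \<phi> b \<and> W \<phi> b \<subset> W \<phi> a \<and> W \<phi> b \<noteq> {} \<and> (b, a) \<notin> E"
    for k :: nat
    by (rule ex) auto
  have "\<exists>f. \<forall>n. P n (f n) \<and> Q (f n) (f (Suc n))"
  proof (rule dependent_nat_choice)
    show "\<exists>x. P 0 x"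
      using ex'[of 0] by (auto simp: P_def)
  next
    fix x n assume "P n x"
    obtain b k where x: "x = (b, k)" by (cases x)
    obtain y where y: "y \<in> W \<phi> a" "y \<notin> W \<phi> b"
      using \<open>P n x\<close> by (auto simp: P_def x)
    \<comment> \<open>The three bounds serve \<open>k_ge\<close>, \<open>k_mono\<close> and
      \<open>b_next\<close> in turn; the last puts the missing element \<open>y\<close> below the
      new threshold.\<close>
    define k' where "k' = max (Suc n) (max k (Suc y))"
    obtain b' where "W \<phi> a \<inter> {..<k'} \<subseteq> W \<phi> b'" "W \<phi> b' \<subset> W \<phi> a" "W \<phi> b' \<noteq> {}" "(b', a) \<notin> E"
      using ex' by blast
    then have "P (Suc n) (b', k') \<and> Q x (b', k')"
      using y by (auto simp: P_def Q_def x k'_def)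
    then show "\<exists>y. P (Suc n) y \<and> Q x y" ..
  qed
  then obtain f where f: "\<And>n. P n (f n)" "\<And>n. Q (f n) (f (Suc n))"
    by blast
  have "approximation \<phi> E a (fst \<circ> f) (snd \<circ> f)"
  proof
    fix n
    show "W \<phi> ((fst \<circ> f) n) \<noteq> {}" "W \<phi> ((fst \<circ> f) n) \<subset> W \<phi> a"
      "W \<phi> a \<inter> {..<(snd \<circ> f) n} \<subseteq> W \<phi> ((fst \<circ> f) n)" "((fst \<circ> f) n, a) \<notin> E"
      "n \<le> (snd \<circ> f) n"
      using f(1)[of n] by (auto simp: P_def split: prod.splits)
    show "\<not> W \<phi> a \<inter> {..<(snd \<circ> f) (Suc n)} \<subseteq> W \<phi> ((fst \<circ> f) n)" "(snd \<circ> f) n \<le> (snd \<circ> f) (Suc n)"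
      using f(2)[of n] by (auto simp: Q_def split: prod.splits)
  qed (use E a in auto)
  then show thesis ..
qed

section \<open>Moving the intervals to the class of the limit set\<close>

context approximation
begin

definition moved :: "nat set \<Rightarrow> nat set set" where
  "moved S = {X. \<exists>n\<in>S. W \<phi> a \<inter> {..<k n} \<subseteq> X \<and> X \<subseteq> W \<phi> (b n)}"

definition target :: "nat set \<Rightarrow> nat \<Rightarrow> nat" where
  "target S e = (if W \<phi> e \<in> moved S then a else e)"

text \<open>As a pullback of \<open>E\<close> this is an equivalence relation at once. A moved set
  leaves its old class, so \<open>S \<subseteq> T\<close> does not give
  \<open>merge S \<subseteq> merge T\<close> in general.\<close>

definition merge :: "nat set \<Rightarrow> nat rel" where
  "merge S = {(x, y). (target S x, target S y) \<in> E}"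

lemma merge_in_R_ce: "merge S \<in> R_ce \<phi>"
proof -
  have "equiv UNIV (merge S)"
  proof (rule equivI)
    show "refl (merge S)"
      using R_ceD(1)[OF E] by (simp add: merge_def refl_on_def)
    show "sym (merge S)"
      unfolding merge_def using R_ceD(2)[OF E] by (auto intro!: symI dest: symD)
    show "trans (merge S)"
      unfolding merge_def using R_ceD(3)[OF E] by (auto intro!: transI dest: transD)
  qed simp
  moreover have "eq_ce \<phi> \<subseteq> merge S"
    using R_ceD(1)[OF E] by (auto simp: eq_ce_def merge_def target_def refl_on_def R_ceD(4)[OF E])
  ultimately show ?thesis
    by (simp add: R_ce_def)
qed

lemma merge_empty: "merge {} = E"
  by (auto simp: merge_def target_def moved_def)

lemma moved_mono: "S \<subseteq> T \<Longrightarrow> moved S \<subseteq> moved T"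
  by (auto simp: moved_def)

lemma k_le: "m \<le> n \<Longrightarrow> k m \<le> k n"
  by (rule lift_Suc_mono_le[of k, OF k_mono])

lemma a_not_moved: "W \<phi> a \<notin> moved S"
  unfolding moved_def using b_below by blast

text \<open>If \<open>n < m\<close>, the finite set of stage \<open>m\<close> contains that of stage
  \<open>n + 1\<close>, which \<open>W \<phi> (b n)\<close> misses. If \<open>m < n\<close>, the
  finite set of stage \<open>n\<close> lies in \<open>W \<phi> (b n)\<close>, hence in
  \<open>W \<phi> (b m)\<close>, which \<open>b_next\<close> forbids.\<close>

lemma b_separated:
  assumes "W \<phi> a \<inter> {..<k m} \<subseteq> W \<phi> (b n)" "W \<phi> (b n) \<subseteq> W \<phi> (b m)"
  shows "m = n"
proof -
  have less: "\<not> W \<phi> a \<inter> {..<k j} \<subseteq> W \<phi> (b i)" if "i < j" for i j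
    using b_next[of i] k_le[of "Suc i" j] that by fastforce
  have "\<not> n < m"
    using less[of n m] assms by auto
  moreover have "\<not> m < n"
    using less[of m n] assms b_above[of n] by auto
  ultimately show ?thesis by simp
qed

lemma b_moved_iff: "W \<phi> (b n) \<in> moved S \<longleftrightarrow> n \<in> S"
proof
  show "n \<in> S" if "W \<phi> (b n) \<in> moved S"
    using that b_separated unfolding moved_def by blast
  show "W \<phi> (b n) \<in> moved S" if "n \<in> S"
    using that b_above unfolding moved_def by blast
qed

text \<open>Only finitely many intervals are relevant below a proper subset of \<open>W \<phi> a\<close>.\<close>

lemma moved_locally_constant:
  assumes "X \<noteq> W \<phi> a"
  shows "\<exists>D. finite D \<and> D \<subseteq> X \<and> (\<forall>Y. D \<subseteq> Y \<longrightarrow> Y \<subseteq> X \<longrightarrow> (Y \<in> moved S \<longleftrightarrow> X \<in> moved S))"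
proof (cases "X \<in> moved S")
  case True
  then obtain n where "n \<in> S" "W \<phi> a \<inter> {..<k n} \<subseteq> X" "X \<subseteq> W \<phi> (b n)"
    by (auto simp: moved_def)
  then show ?thesis
    using True by (intro exI[of _ "W \<phi> a \<inter> {..<k n}"]) (simp, force simp: moved_def)
next
  case False
  show ?thesis
  proof (cases "X \<subseteq> W \<phi> a")
    case False
    then obtain z where "z \<in> X" "z \<notin> W \<phi> a" by blast
    then have "Y \<notin> moved S" if "z \<in> Y" for Y
      using that b_below by (fastforce simp: moved_def)
    then show ?thesis
      using \<open>X \<notin> moved S\<close> \<open>z \<in> X\<close> by (intro exI[of _ "{z}"]) auto
  next
    case True
    then obtain x where x: "x \<in> W \<phi> a" "x \<notin> X" using assms by blast
    define pick where "pick n = (SOME y. y \<in> X \<and> y \<notin> W \<phi> (b n))" for n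
    have pick: "pick n \<in> X \<and> pick n \<notin> W \<phi> (b n)" if "\<not> X \<subseteq> W \<phi> (b n)" for n
      unfolding pick_def by (rule someI_ex) (use that in blast)
    \<comment> \<open>An interval that meets the subsets of \<open>X\<close> has its lower end
      inside \<open>X\<close>, so its threshold cannot exceed the missing point \<open>x\<close>.
      This leaves finitely many \<open>n\<close>, and the witness \<open>pick n\<close> keeps
      \<open>Y\<close> out of interval \<open>n\<close>.\<close>
    define D where "D = pick ` {n. n \<le> x \<and> \<not> X \<subseteq> W \<phi> (b n)}"
    have "Y \<notin> moved S" if Y: "D \<subseteq> Y" "Y \<subseteq> X" for Y
    proof
      assume "Y \<in> moved S"
      then obtain n where n: "n \<in> S" "W \<phi> a \<inter> {..<k n} \<subseteq> Y" "Y \<subseteq> W \<phi> (b n)"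
        by (auto simp: moved_def)
      \<comment> \<open>Otherwise \<open>X\<close>, which contains the lower end via
        \<open>Y\<close>, would itself lie in interval \<open>n\<close>.\<close>
      then have "\<not> X \<subseteq> W \<phi> (b n)"
        using \<open>X \<notin> moved S\<close> Y(2) by (auto simp: moved_def)
      moreover have "n \<le> x"
        using n(2) x Y(2) k_ge[of n] by (force simp: not_le[symmetric])
      ultimately have "pick n \<in> Y"
        using Y(1) by (auto simp: D_def)
      then show False
        using pick[OF \<open>\<not> X \<subseteq> W \<phi> (b n)\<close>] n(3) by blast
    qed
    moreover have "finite D" "D \<subseteq> X"
      using pick by (auto simp: D_def)
    ultimately show ?thesis
      using \<open>X \<notin> moved S\<close> by blast
  qed
qed

text \<open>At \<open>W \<phi> a\<close> containment is immediate: enlarging \<open>S\<close> only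
  brings more sets to the class of \<open>a\<close>. Elsewhere, sets \<open>W \<phi> d\<close> close
  to \<open>W \<phi> c\<close> from below are moved exactly when \<open>W \<phi> c\<close> is, both
  for \<open>S\<close> and for \<open>T\<close>. So either \<open>T\<close> moves both, or neither
  is moved and both relations amount to \<open>E\<close>.\<close>

lemma merge_mono:
  assumes "S \<subseteq> T"
  shows "learn_le \<phi> (merge S) (merge T)"
proof (rule learn_leI[OF merge_in_R_ce merge_in_R_ce])
  fix c
  show "\<exists>D. finite D \<and> D \<subseteq> W \<phi> c \<and>
      (\<forall>b. D \<subseteq> W \<phi> b \<longrightarrow> W \<phi> b \<subseteq> W \<phi> c \<longrightarrow> (b, c) \<in> merge S \<longrightarrow> (b, c) \<in> merge T)"
  proof (cases "W \<phi> c = W \<phi> a")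
    case True
    have "(a, c) \<in> E"
      using True R_ceD(4)[OF E] by simp
    have "(d, c) \<in> merge T" if "(d, c) \<in> merge S" for d
      using that \<open>(a, c) \<in> E\<close> moved_mono[OF assms] a_not_moved[of S] a_not_moved[of T] True
      by (simp add: merge_def target_def split: if_splits) blast
    then show ?thesis
      by (intro exI[of _ "{}"]) simp
  next
    case False
    obtain D D' where
      "finite D" "D \<subseteq> W \<phi> c" "finite D'" "D' \<subseteq> W \<phi> c" and
      D: "\<And>Y. D \<subseteq> Y \<Longrightarrow> Y \<subseteq> W \<phi> c \<Longrightarrow> Y \<in> moved S \<longleftrightarrow> W \<phi> c \<in> moved S" and
      D': "\<And>Y. D' \<subseteq> Y \<Longrightarrow> Y \<subseteq> W \<phi> c \<Longrightarrow> Y \<in> moved T \<longleftrightarrow> W \<phi> c \<in> moved T"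
      using moved_locally_constant[OF False] by metis
    moreover have "(d, c) \<in> merge T"
      if "D \<union> D' \<subseteq> W \<phi> d" "W \<phi> d \<subseteq> W \<phi> c" "(d, c) \<in> merge S" for d
      using that D[of "W \<phi> d"] D'[of "W \<phi> d"] moved_mono[OF assms] R_ceD(1)[OF E]
      by (auto simp: merge_def target_def refl_on_def split: if_splits)
    ultimately show ?thesis
      by (intro exI[of _ "D \<union> D'"]) auto
  qed
qed

text \<open>The separating family is \<open>W \<phi> a\<close> with all
  \<open>W \<phi> (b n)\<close> for \<open>n \<in> S - T\<close>. Under \<open>merge S\<close> it
  falls into one class, so empty tell-tales suffice; under \<open>merge T\<close> the
  \<open>b n\<close> stay inequivalent to \<open>a\<close>, yet infinitely many of them contain any
  given finite part of \<open>W \<phi> a\<close>.\<close>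

lemma merge_not_le:
  assumes "infinite (S - T)"
  shows "\<not> learn_le \<phi> (merge S) (merge T)"
proof
  assume le: "learn_le \<phi> (merge S) (merge T)"
  define K where "K = insert (W \<phi> a) ((\<lambda>n. W \<phi> (b n)) ` (S - T))"
  have K: "ce_family \<phi> K"
    using a_nonempty b_nonempty by (auto simp: ce_family_def K_def)
  have all_E: "(target S e, a) \<in> E" if "W \<phi> e \<in> K" for e
  proof (cases "W \<phi> e = W \<phi> a")
    case True
    then show ?thesis
      using a_not_moved R_ceD(4)[OF E] by (simp add: target_def)
  next
    case False
    then have "W \<phi> e \<in> moved S"
      using that b_moved_iff by (auto simp: K_def)
    then show ?thesis
      using R_ceD(1)[OF E] by (simp add: target_def refl_on_def)
  qed
  have "(target S d, target S e) \<in> E" if "W \<phi> d \<in> K" "W \<phi> e \<in> K" for d e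
    using all_E[OF that(1)] all_E[OF that(2)] R_ceD(2,3)[OF E] by (metis symD transD)
  then have "telltale \<phi> (merge S) K e {}" if "W \<phi> e \<in> K" for e
    using that by (simp add: telltale_def merge_def)
  then have "learnable \<phi> (merge T) K"
    using le K merge_in_R_ce learnable_iff_telltales by (metis learn_le_def)
  then obtain D where D: "telltale \<phi> (merge T) K a D"
    using K merge_in_R_ce learnable_iff_telltales by (metis K_def insertI1)
  then obtain N where "\<forall>x\<in>D. x < N"
    using finite_nat_set_iff_bounded by (auto simp: telltale_def)
  obtain n where n: "n \<in> S - T" "n \<ge> N"
    using iffD1[OF infinite_nat_iff_unbounded_le assms] by metis
  have "D \<subseteq> W \<phi> (b n)"
  proof
    fix x assume "x \<in> D"
    then have "x < k n"
      using \<open>\<forall>x\<in>D. x < N\<close> n(2) k_ge[of n] by (meson order_less_le_trans order_trans)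
    then show "x \<in> W \<phi> (b n)"
      using D \<open>x \<in> D\<close> b_above[of n] unfolding telltale_def by blast
  qed
  then have "(b n, a) \<in> merge T"
    using D n(1) b_below[of n] unfolding telltale_def K_def by blast
  then show False
    using b_not_E[of n] n(1) b_moved_iff[of n T] a_not_moved[of T]
    by (simp add: merge_def target_def)
qed

end

section \<open>An almost disjoint family\<close>

text \<open>The nodes of the full binary tree on the path \<open>r\<close>, coded as
  numbers.\<close>

definition branch :: "(nat \<Rightarrow> bool) \<Rightarrow> nat set" where
  "branch r = range (\<lambda>n. to_nat (map r [0..<n]))"

lemma infinite_branch: "infinite (branch r)"
proof -
  have "inj (\<lambda>n. to_nat (map r [0..<n]))"
    by (rule injI) (metis diff_zero injD inj_to_nat length_map length_upt)
  then show ?thesis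
    unfolding branch_def by (simp add: finite_image_iff)
qed

text \<open>A common node has length at most any position \<open>j\<close> at which the two paths
  differ.\<close>

lemma finite_branch_Int:
  assumes "r \<noteq> q"
  shows "finite (branch r \<inter> branch q)"
proof -
  obtain j where j: "r j \<noteq> q j" using assms by blast
  have "branch r \<inter> branch q \<subseteq> (\<lambda>n. to_nat (map r [0..<n])) ` {..j}"
  proof
    fix x assume "x \<in> branch r \<inter> branch q"
    then obtain n m where n: "x = to_nat (map r [0..<n])" and m: "x = to_nat (map q [0..<m])"
      unfolding branch_def by blast
    then have eq: "map r [0..<n] = map q [0..<m]" by simp
    then have "n = m" by (metis diff_zero length_map length_upt)
    then have "\<not> j < n" using eq j by (auto simp: map_eq_conv)
    then show "x \<in> (\<lambda>n. to_nat (map r [0..<n])) ` {..j}" using n by auto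
  qed
  then show ?thesis by (rule finite_subset) simp
qed

lemma infinite_branch_diff:
  assumes "finite Q" "r \<notin> Q"
  shows "infinite (branch r - (\<Union>q\<in>Q. branch q))"
proof -
  have "finite (\<Union>q\<in>Q. branch r \<inter> branch q)"
    using assms by (intro finite_UN_I finite_branch_Int) auto
  then have "infinite (branch r - (\<Union>q\<in>Q. branch r \<inter> branch q))"
    using infinite_branch by (rule Diff_infinite_finite)
  then show ?thesis
    by (rule back_subst[of infinite]) blast
qed

section \<open>The embedding\<close>

lemma TLH_embedding:
  assumes "E \<in> R_ce \<phi>" "\<not> universal \<phi> E"
  shows "\<exists>\<iota> :: (nat \<Rightarrow> bool) set \<Rightarrow> nat rel set.
    order_embedding (Fpow UNIV) (\<subseteq>) (TLH \<phi>) (TLH_le \<phi>) \<iota> \<and>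
    \<iota> {} = learn_class \<phi> E \<and>
    (\<forall>P\<in>Fpow UNIV. strictly_below (TLH_le \<phi>) (\<iota> P) (learn_class \<phi> Id_1))"
proof -
  obtain a b k where "approximation \<phi> E a b k"
    using approximation_exists[OF assms] .
  then interpret approximation \<phi> E a b k .
  define F where "F P = merge (\<Union>r\<in>P. branch r)" for P
  have F: "F P \<in> R_ce \<phi>" for P
    by (simp add: F_def merge_in_R_ce)
  have F_not_le: "\<not> learn_le \<phi> (F P) (F Q)" if "finite Q" "r \<in> P" "r \<notin> Q" for P Q r
  proof -
    have "infinite ((\<Union>r\<in>P. branch r) - (\<Union>r\<in>Q. branch r))"
      by (rule infinite_super[OF _ infinite_branch_diff[OF that(1,3)]]) (use that in blast)
    then show ?thesis unfolding F_def by (rule merge_not_le)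
  qed
  \<comment> \<open>Only the right-hand index set is assumed finite, so that \<open>P = UNIV\<close>
    is allowed.\<close>
  have F_le_iff: "learn_le \<phi> (F P) (F Q) \<longleftrightarrow> P \<subseteq> Q" if "finite Q" for P Q
  proof
    show "learn_le \<phi> (F P) (F Q)" if "P \<subseteq> Q"
      unfolding F_def using that by (intro merge_mono) blast
  qed (use F_not_le that in blast)
  have F_top: "\<not> learn_le \<phi> Id_1 (F P)" if "finite P" for P
  proof
    assume "learn_le \<phi> Id_1 (F P)"
    \<comment> \<open>Comparing with \<open>F UNIV\<close> would force
      \<open>UNIV \<subseteq> P\<close>, although there are infinitely many paths.\<close>
    then have "learn_le \<phi> (F UNIV) (F P)"
      using learn_le_Id_1 learn_le_trans by blast
    then have "finite (UNIV :: (nat \<Rightarrow> bool) set)"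
      using F_le_iff[OF that] that by (metis finite_subset)
    then have "finite (UNIV :: nat set)"
      by (rule finite_fun_UNIVD1) simp
    then show False by simp
  qed
  show ?thesis
  proof (intro exI[of _ "\<lambda>P. learn_class \<phi> (F P)"] conjI ballI)
    show "order_embedding (Fpow UNIV) (\<subseteq>) (TLH \<phi>) (TLH_le \<phi>) (\<lambda>P. learn_class \<phi> (F P))"
      using F F_le_iff learn_class_in_TLH
      by (auto simp: order_embedding_def Fpow_def TLH_le_learn_class)
    show "learn_class \<phi> (F {}) = learn_class \<phi> E"
      by (simp add: F_def merge_empty)
    show "strictly_below (TLH_le \<phi>) (learn_class \<phi> (F P)) (learn_class \<phi> Id_1)"
      if "P \<in> Fpow UNIV" for P
      using that F F_top[of P] learn_le_Id_1
      by (simp add: Fpow_def strictly_below_def TLH_le_learn_class learn_class_eq_iff Id_1_in_R_ce)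
  qed
qed

text \<open>A class below the top comes from a non-universal relation, so it is the image of the
  empty set under an embedding; the image of a singleton then lies strictly between it and the
  top.\<close>

lemma TLH_coatomless: "coatomless (TLH \<phi>) (TLH_le \<phi>)"
  unfolding coatomless_def
proof
  assume "\<exists>x. coatom (TLH \<phi>) (TLH_le \<phi>) x"
  then obtain x t where "x \<in> TLH \<phi>" and t: "is_top (TLH \<phi>) (TLH_le \<phi>) t"
    and x: "strictly_below (TLH_le \<phi>) x t"
    and no: "\<not> (\<exists>y\<in>TLH \<phi>. strictly_below (TLH_le \<phi>) x y \<and> strictly_below (TLH_le \<phi>) y t)"
    unfolding coatom_def by blast
  have t_eq: "t = learn_class \<phi> Id_1"
    using t TLH_top[of \<phi>] antisymp_onD[OF TLH_poset(2)] by (metis is_top_def)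
  obtain E where E: "E \<in> R_ce \<phi>" "x = learn_class \<phi> E"
    using \<open>x \<in> TLH \<phi>\<close> by (rule TLH_cases)
  have "\<not> learn_le \<phi> Id_1 E"
    using x learn_le_Id_1[of \<phi> E]
    by (auto simp: E t_eq strictly_below_def learn_class_eq_iff Id_1_in_R_ce)
  then have "\<not> universal \<phi> E"
    using learn_less_Id_1_iff[of \<phi> E] learn_le_Id_1 by (simp add: learn_less_def)
  then obtain \<iota> :: "(nat \<Rightarrow> bool) set \<Rightarrow> nat rel set" where
    \<iota>: "order_embedding (Fpow UNIV) (\<subseteq>) (TLH \<phi>) (TLH_le \<phi>) \<iota>" "\<iota> {} = x"
    and below: "\<And>P. P \<in> Fpow UNIV \<Longrightarrow> strictly_below (TLH_le \<phi>) (\<iota> P) t"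
    using TLH_embedding[OF E(1)] E(2) t_eq by metis
  define P :: "(nat \<Rightarrow> bool) set" where "P = {\<lambda>_. True}"
  have P: "P \<in> Fpow UNIV" "{} \<in> Fpow (UNIV :: (nat \<Rightarrow> bool) set)"
    by (simp_all add: P_def Fpow_def)
  have "\<iota> P \<in> TLH \<phi>" "TLH_le \<phi> (\<iota> {}) (\<iota> P)" "\<not> TLH_le \<phi> (\<iota> P) (\<iota> {})"
    using \<iota>(1) P by (auto simp: order_embedding_def P_def)
  moreover have "TLH_le \<phi> (\<iota> {}) (\<iota> {})"
    using \<iota>(1) P by (auto simp: order_embedding_def)
  ultimately have "strictly_below (TLH_le \<phi>) x (\<iota> P)"
    unfolding \<iota>(2) strictly_below_def by metis
  then show False
    using no below P \<open>\<iota> P \<in> TLH \<phi>\<close> by blast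
qed

theorem theorem4p15:
  fixes \<phi> :: "nat \<Rightarrow> nat \<Rightarrow> nat option"
  assumes "acceptable_numbering \<phi>"
  shows "(\<forall>E\<in>R_ce \<phi>.
            (learn_less \<phi> E Id_1 \<longleftrightarrow> \<not> universal \<phi> E) \<and>
            (learn_less \<phi> E Id_1 \<longrightarrow>
              (\<exists>\<iota> :: (nat \<Rightarrow> bool) set \<Rightarrow> nat rel set.
                 order_embedding (Fpow UNIV) (\<subseteq>) (TLH \<phi>) (TLH_le \<phi>) \<iota> \<and>
                 \<iota> {} = learn_class \<phi> E \<and>
                 (\<forall>P\<in>Fpow UNIV. strictly_below (TLH_le \<phi>) (\<iota> P) (learn_class \<phi> Id_1))))) \<and>
         coatomless (TLH \<phi>) (TLH_le \<phi>)"
proof (intro conjI ballI impI)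
  fix E assume "E \<in> R_ce \<phi>" "learn_less \<phi> E Id_1"
  then show "\<exists>\<iota> :: (nat \<Rightarrow> bool) set \<Rightarrow> nat rel set.
      order_embedding (Fpow UNIV) (\<subseteq>) (TLH \<phi>) (TLH_le \<phi>) \<iota> \<and>
      \<iota> {} = learn_class \<phi> E \<and>
      (\<forall>P\<in>Fpow UNIV. strictly_below (TLH_le \<phi>) (\<iota> P) (learn_class \<phi> Id_1))"
    using TLH_embedding by (simp add: learn_less_Id_1_iff)
qed (rule learn_less_Id_1_iff TLH_coatomless)+

end
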